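(* Let $n\ge2$ and let $A=(a_{ij})$ be the $n\times n$ symmetric tridiagonal nonnegative adjacency matrix of a one-path graph on vertices $1,\ldots,n$ (so $a_{i,i+1}=a_{i+1,i}>0$ for $1\le i\le n-1$, with possible loops $a_{ii}\ge0$). Let $P$, $\lambda_i$, $\nu_i$, $\pi_i$, $\sigma_k$ and $\mu$ be as in the context. Then for every integer $q$ with $1\le q\le n-1$, the centrality of the edge $\{q,q+1\}$ is $$\mu(q,q+1)=\frac{\sigma_{q-1}(1-\sigma_{q-1})}{\lambda_{q-1}\pi_{q-1}},$$ where $\sigma_k=\sum_{j=0}^k\pi_j$, $\bm\pi^\top P=\bm\pi^\top$, and the components $\pi_i$ of $\bm\pi$ satisfy $$\pi_0=\Big(1+\sum_{i=1}^{n-1}\prod_{\ell=0}^{i-1}\frac{\lambda_\ell}{\nu_{\ell+1}}\Big)^{-1},\qquad \pi_i=\pi_0\prod_{\ell=0}^{i-1}\frac{\lambda_\ell}{\nu_{\ell+1}}\quad(1\le i\le n-1).$$ Moreover, in the case of unitary weights ($a_{i,i+1}=a_{i+1,i}=1$ for $1\le i\le n-1$ and all other entries of $A$ equal to $0$), one has $\lambda_0=\nu_{n-1}=1$, $\lambda_q=\nu_{n-q-1}=\frac12$ for $1\le q\le n-2$, $$\bm\pi^\top=\frac{1}{n-1}\left[\tfrac12,1,\ldots,1,\tfrac12\right],\qquad \sigma_q=\frac{2q+1}{2(n-1)}\quad(0\le q\le n-2),$$ and for every $1\le q\le n-1$, $$\mu(q,q+1)=\frac{1}{2(n-1)}(2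q-1)(2n-2q-1).$$
   Context: Let $\bm 1$ be the all-ones vector, $\bm e_i$ the $i$-th standard basis vector, $\bm d=A\bm 1=(d_i)$, $D=\mathrm{diag}(\bm d)$, and $P=D^{-1}A$, which is an irreducible tridiagonal stochastic matrix. Indexing rows from $0$ to $n-1$, its entries are denoted: diagonal entries $\theta_0,\ldots,\theta_{n-1}\ge 0$, superdiagonal entries $\lambda_0,\ldots,\lambda_{n-2}$ ($\lambda_i$ in row $i$), and subdiagonal entries $\nu_1,\ldots,\nu_{n-1}$ ($\nu_i$ in row $i$). That is, $\lambda_{i-1}=a_{i,i+1}/d_i$ and $\nu_i=a_{i+1,i}/d_{i+1}$ for $1\le i\le n-1$, and $\theta_{i-1}=a_{ii}/d_i$ for $1\le i\le n$. The vector $\bm\pi=(\pi_0,\ldots,\pi_{n-1})^\top$ is the stationary distribution of $P$: the nonnegative vector with entries summing to $1$ and $\bm\pi^\top P=\bm\pi^\top$. Kemeny's constant: for a real $n\times n$ matrix $Q$ with $Q\bm 1=\bm 1$, put $\kappa(Q)=\mathrm{trace}\big((I-Q+\bm 1\bm v^\top)^{-1}\big)-1$, where $\bm v\in\mathbb R^n$ is any vector with $\bm v^\top\bm 1=1$; it is defined whenever the inverse exists and does not depend on $\bm v$. The (weighted) centrality of the edge $\{p,q\}$ is $$\mu(p,q)=\lim_{t\to0^+}\frac{\kappa(P+t\,a_{pq}D^{-1}\bm w_{pq}\bm w_{pq}^\top)-\kappa(P)}{t},\qquad \bm w_{pq}=\bm e_p-\bm e_q.$$ *)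

theory Defs
  imports Complex_Main "Jordan_Normal_Form.Gauss_Jordan_Elimination"
begin

text \<open>
  Graph vertices are numbered from 1 and matrices from 0, so vertex \<open>p\<close> is row and column
  \<open>p - 1\<close> and the weight \<open>a\<^sub>p\<^sub>q\<close> is \<open>A $$ (p - 1, q - 1)\<close>. The entries of the transition
  matrix and of its stationary distribution are numbered from 0 on both sides.
\<close>

definition ones :: "nat \<Rightarrow> real vec" where
  "ones n = vec n (\<lambda>_. 1)"

definition outer_prod :: "real vec \<Rightarrow> real vec \<Rightarrow> real mat" where
  "outer_prod v w = mat (dim_vec v) (dim_vec w) (\<lambda>(i, j). v $ i * w $ j)"

definition mat_trace :: "real mat \<Rightarrow> real" where
  "mat_trace M = (\<Sum>i<dim_row M. M $$ (i, i))"

text \<open>Only meaningful for invertible \<open>M\<close>; unspecified otherwise.\<close>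
definition inv_mat :: "real mat \<Rightarrow> real mat" where
  "inv_mat M = the (mat_inverse M)"

definition one_path_adjacency :: "nat \<Rightarrow> real mat \<Rightarrow> bool" where
  "one_path_adjacency n A \<longleftrightarrow>
     A \<in> carrier_mat n n \<and>
     transpose_mat A = A \<and>
     (\<forall>i<n. \<forall>j<n. A $$ (i, j) \<ge> 0) \<and>
     (\<forall>i<n. \<forall>j<n. i + 1 < j \<or> j + 1 < i \<longrightarrow> A $$ (i, j) = 0) \<and>
     (\<forall>i. i + 1 < n \<longrightarrow> A $$ (i, i + 1) > 0)"

definition degree_vec :: "real mat \<Rightarrow> real vec" where
  "degree_vec A = A *\<^sub>v ones (dim_col A)"

definition degree_mat :: "real mat \<Rightarrow> real mat" where
  "degree_mat A = mat_diag (dim_row A) (\<lambda>i. degree_vec A $ i)"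

definition transition_mat :: "real mat \<Rightarrow> real mat" where
  "transition_mat A = inv_mat (degree_mat A) * A"

definition is_stationary_distribution :: "real mat \<Rightarrow> real vec \<Rightarrow> bool" where
  "is_stationary_distribution P x \<longleftrightarrow>
     x \<in> carrier_vec (dim_row P) \<and>
     (\<forall>i<dim_row P. x $ i \<ge> 0) \<and>
     (\<Sum>i<dim_row P. x $ i) = 1 \<and>
     transpose_mat P *\<^sub>v x = x"

definition stationary_distribution :: "real mat \<Rightarrow> real vec" where
  "stationary_distribution P = (THE x. is_stationary_distribution P x)"

text \<open>
  \<open>has_kemeny Q c\<close> says that the inverse exists and yields the value \<open>c\<close> for every admissible
  auxiliary vector \<open>v\<close>, so the independence of the choice of \<open>v\<close> is part of being defined.
\<close>
definition has_kemeny :: "real mat \<Rightarrow> real \<Rightarrow> bool" where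
  "has_kemeny Q c \<longleftrightarrow>
     square_mat Q \<and>
     Q *\<^sub>v ones (dim_row Q) = ones (dim_row Q) \<and>
     (\<forall>v \<in> carrier_vec (dim_row Q). v \<bullet> ones (dim_row Q) = 1 \<longrightarrow>
        (let M = 1\<^sub>m (dim_row Q) - Q + outer_prod (ones (dim_row Q)) v
         in invertible_mat M \<and> mat_trace (inv_mat M) - 1 = c))"

definition kemeny_defined :: "real mat \<Rightarrow> bool" where
  "kemeny_defined Q \<longleftrightarrow> (\<exists>c. has_kemeny Q c)"

definition kemeny :: "real mat \<Rightarrow> real" where
  "kemeny Q = (THE c. has_kemeny Q c)"

definition edge_vec :: "nat \<Rightarrow> nat \<Rightarrow> nat \<Rightarrow> real vec" where
  "edge_vec n p q = unit_vec n (p - 1) - unit_vec n (q - 1)"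

definition perturbed_transition_mat :: "real mat \<Rightarrow> nat \<Rightarrow> nat \<Rightarrow> real \<Rightarrow> real mat" where
  "perturbed_transition_mat A p q t =
     (let w = edge_vec (dim_row A) p q
      in transition_mat A
           + (t * A $$ (p - 1, q - 1)) \<cdot>\<^sub>m (inv_mat (degree_mat A) * outer_prod w w))"

definition kemeny_quotient :: "real mat \<Rightarrow> nat \<Rightarrow> nat \<Rightarrow> real \<Rightarrow> real" where
  "kemeny_quotient A p q t =
     (kemeny (perturbed_transition_mat A p q t) - kemeny (transition_mat A)) / t"

definition edge_centrality :: "real mat \<Rightarrow> nat \<Rightarrow> nat \<Rightarrow> real" where
  "edge_centrality A p q = Lim (at_right 0) (kemeny_quotient A p q)"

text \<open>
  Since \<open>kemeny\<close> and \<open>Lim\<close> are total functions, the existence of all the quantities entering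
  \<open>edge_centrality\<close> is recorded separately.
\<close>
definition edge_centrality_exists :: "real mat \<Rightarrow> nat \<Rightarrow> nat \<Rightarrow> bool" where
  "edge_centrality_exists A p q \<longleftrightarrow>
     kemeny_defined (transition_mat A) \<and>
     (\<forall>\<^sub>F t in at_right 0. kemeny_defined (perturbed_transition_mat A p q t)) \<and>
     (\<exists>m. (kemeny_quotient A p q \<longlongrightarrow> m) (at_right 0))"

end

theory Submission
  imports Defs "Jordan_Normal_Form.Determinant"
begin

text \<open>
  With \<open>d\<^sub>i\<close> the degrees, \<open>m\<close> their sum, \<open>c\<^sub>k\<close> the weight of the edge from row \<open>k\<close> to row \<open>k + 1\<close>
  and \<open>\<sigma>\<^sub>k = (d\<^sub>0 + \<dots> + d\<^sub>k) / m\<close>, the matrix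
  \<open>G\<^sub>i\<^sub>j = d\<^sub>j (\<Sum>\<^sub>k [i \<le> k] ([j \<le> k] - \<sigma>\<^sub>k) / c\<^sub>k)\<close> satisfies \<open>(I - P) G = I - 1 \<pi>\<^sup>T\<close> with
  \<open>\<pi>\<^sub>i = d\<^sub>i / m\<close>: its columns are the potentials of unit currents along the path. This identity
  shows that \<open>\<pi>\<close> is the only stationary distribution, and that Kemeny's constant is
  \<open>trace G = \<Sum>\<^sub>k m \<sigma>\<^sub>k (1 - \<sigma>\<^sub>k) / c\<^sub>k\<close>. The perturbation by \<open>t\<close> moves the fraction \<open>t\<close> of one
  edge weight into loops at its ends. The degrees do not change, so the perturbed matrix again
  comes from a path, and only the summand of that edge varies, by the factor \<open>1 / (1 - t)\<close>.
\<close>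

section \<open>Matrix inverses, indicator sums and uniqueness of Kemeny's constant\<close>

lemma inv_mat_eqI:
  assumes M: "M \<in> carrier_mat n n" and N: "N \<in> carrier_mat n n" and MN: "M * N = 1\<^sub>m n"
  shows "invertible_mat M" and "inv_mat M = N"
proof -
  have NM: "N * M = 1\<^sub>m n"
    using mat_mult_left_right_inverse[OF M N MN] .
  show "invertible_mat M"
    unfolding invertible_mat_def inverts_mat_def using M N MN NM by auto
  \<comment> \<open>\<open>mat_inverse\<close> can return \<open>None\<close> only on non-units of
    the matrix ring, so being a unit secures a value for \<open>the\<close>.\<close>
  have "M \<in> Units (ring_mat TYPE(real) n ())"
    unfolding Units_def ring_mat_def using M N MN NM by auto
  then obtain B where B: "mat_inverse M = Some B"
    using mat_inverse(1)[OF M, where b = "()"] by (cases "mat_inverse M") auto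
  then have BM: "B * M = 1\<^sub>m n" and Bc: "B \<in> carrier_mat n n"
    using mat_inverse(2)[OF M B] by auto
  have "B = B * (M * N)" using MN Bc by simp
  also have "\<dots> = (B * M) * N" using Bc M N by simp
  finally have "B = N" using BM N by simp
  then show "inv_mat M = N" unfolding inv_mat_def B by simp
qed

lemma sum_atMost_eq_sum_of_bool:
  fixes f :: "nat \<Rightarrow> real"
  assumes "k < n"
  shows "(\<Sum>i<n. f i * of_bool (i \<le> k)) = (\<Sum>i\<le>k. f i)"
proof -
  have "(\<Sum>i\<le>k. f i) = (\<Sum>i\<le>k. f i * of_bool (i \<le> k))" by simp
  also have "\<dots> = (\<Sum>i<n. f i * of_bool (i \<le> k))"
    using assms by (intro sum.mono_neutral_left) auto
  finally show ?thesis by simp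
qed

lemma sum_of_bool_eq:
  fixes f :: "nat \<Rightarrow> real"
  assumes "i < n"
  shows "(\<Sum>l<n. f l * of_bool (l = i)) = f i" "(\<Sum>l<n. f l * of_bool (i = l)) = f i"
proof -
  have "(\<Sum>l<n. f l * of_bool (l = i)) = (\<Sum>l<n. if l = i then f l else 0)"
    by (intro sum.cong) auto
  then show "(\<Sum>l<n. f l * of_bool (l = i)) = f i" using assms by simp
  then show "(\<Sum>l<n. f l * of_bool (i = l)) = f i" by (simp only: eq_commute)
qed

lemma has_kemeny_unique:
  assumes "has_kemeny Q c" "has_kemeny Q c'" "0 < dim_row Q"
  shows "c = c'"
proof -
  \<comment> \<open>One admissible auxiliary vector pins the value down. In dimension 0 there is
    none, and \<open>has_kemeny\<close> would hold vacuously for every value.\<close>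
  let ?v = "unit_vec (dim_row Q) 0 :: real vec"
  have "?v \<in> carrier_vec (dim_row Q)" by simp
  moreover have "?v \<bullet> ones (dim_row Q) = 1"
    using assms(3) by (simp add: ones_def)
  ultimately show ?thesis
    using assms(1,2) unfolding has_kemeny_def Let_def by fastforce
qed

section \<open>Degrees and cumulative weights of a path\<close>

locale one_path =
  fixes n :: nat and A :: "real mat"
  assumes two_le: "2 \<le> n" and adj: "one_path_adjacency n A"
begin

lemma A_carrier: "A \<in> carrier_mat n n"
  using adj by (simp add: one_path_adjacency_def)

lemma A_dim [simp]: "dim_row A = n" "dim_col A = n"
  using A_carrier by auto

lemma A_nonneg: "i < n \<Longrightarrow> j < n \<Longrightarrow> 0 \<le> A $$ (i, j)"
  using adj by (simp add: one_path_adjacency_def)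

lemma A_far: "i < n \<Longrightarrow> j < n \<Longrightarrow> i + 1 < j \<or> j + 1 < i \<Longrightarrow> A $$ (i, j) = 0"
  using adj unfolding one_path_adjacency_def by blast

lemma A_edge: "Suc k < n \<Longrightarrow> 0 < A $$ (k, Suc k)"
  using adj by (simp add: one_path_adjacency_def)

lemma A_sym: "i < n \<Longrightarrow> j < n \<Longrightarrow> A $$ (i, j) = A $$ (j, i)"
proof -
  assume "i < n" "j < n"
  then have "transpose_mat A $$ (i, j) = A $$ (j, i)" by simp
  then show ?thesis using adj by (simp add: one_path_adjacency_def)
qed

definition deg :: "nat \<Rightarrow> real" where
  "deg i = (\<Sum>j<n. A $$ (i, j))"

definition vol :: real where
  "vol = (\<Sum>i<n. deg i)"

text \<open>This is the \<sigma> of the overview, defined by degrees so that it is available before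
  the stationary distribution is known.\<close>

definition cum :: "nat \<Rightarrow> real" where
  "cum k = (\<Sum>i\<le>k. deg i) / vol"

lemma deg_pos:
  assumes "i < n"
  shows "0 < deg i"
proof -
  obtain j where j: "j < n" "0 < A $$ (i, j)"
  proof (cases "Suc i < n")
    case True
    then show ?thesis using that A_edge by blast
  next
    case False
    then obtain k where "i = Suc k" using assms two_le by (cases i) auto
    then show ?thesis using that[of k] A_edge[of k] A_sym[of i k] assms by simp
  qed
  then show ?thesis
    unfolding deg_def using assms A_nonneg by (intro sum_pos2[of _ j]) auto
qed

lemma deg_nonzero [simp]: "i < n \<Longrightarrow> deg i \<noteq> 0"
  using deg_pos by fastforce

lemma vol_pos: "0 < vol"
  unfolding vol_def using two_le deg_pos by (intro sum_pos) (auto simp: lessThan_empty_iff)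

lemma vol_nonzero [simp]: "vol \<noteq> 0"
  using vol_pos by simp

lemma cum_last: "cum (n - 1) = 1"
proof -
  have "{..n - 1} = {..<n}" using two_le by auto
  then show ?thesis unfolding cum_def by (simp flip: vol_def)
qed

lemma cum_Suc: "cum (Suc k) - cum k = deg (Suc k) / vol"
  by (simp add: cum_def add_divide_distrib)

section \<open>The Laplacian of a path and its Green matrix\<close>

text \<open>The Laplacian \<open>D - A\<close> is applied to the indicator of the rows up to
  \<open>k\<close>. Neighbours on the same side of the cut cancel, loops included, and the only edge
  crossing the cut joins \<open>k\<close> and \<open>Suc k\<close>.\<close>

lemma laplacian_step:
  assumes i: "i < n" and k: "Suc k < n"
  shows "deg i * of_bool (i \<le> k) - (\<Sum>l<n. A $$ (i, l) * of_bool (l \<le> k))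
           = A $$ (k, Suc k) * (of_bool (i = k) - of_bool (i = Suc k))"
proof -
  have "deg i * of_bool (i \<le> k) - (\<Sum>l<n. A $$ (i, l) * of_bool (l \<le> k))
          = (\<Sum>l<n. A $$ (i, l) * (of_bool (i \<le> k) - of_bool (l \<le> k)))"
    by (simp add: deg_def sum_distrib_right right_diff_distrib sum_subtractf)
  also have "\<dots> = (\<Sum>l<n. (if l = Suc k then A $$ (k, Suc k) * of_bool (i = k) else 0)
                        - (if l = k then A $$ (k, Suc k) * of_bool (i = Suc k) else 0))"
  proof (rule sum.cong)
    fix l assume "l \<in> {..<n}"
    then have l: "l < n" by simp
    show "A $$ (i, l) * (of_bool (i \<le> k) - of_bool (l \<le> k))
        = (if l = Suc k then A $$ (k, Suc k) * of_bool (i = k) else 0)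
          - (if l = k then A $$ (k, Suc k) * of_bool (i = Suc k) else 0)"
    proof (cases "i \<le> k \<longleftrightarrow> l \<le> k")
      case True
      then show ?thesis by auto
    next
      case False
      show ?thesis
      proof (cases "A $$ (i, l) = 0")
        case True
        then show ?thesis using A_edge[OF k] A_sym[OF i l] by auto
      next
        case nz: False
        then have "\<not> i + 1 < l" "\<not> l + 1 < i" using A_far[OF i l] by auto
        then have "(i = k \<and> l = Suc k) \<or> (i = Suc k \<and> l = k)" using False by auto
        then show ?thesis using A_sym[OF i l] by auto
      qed
    qed
  qed simp
  also have "\<dots> = A $$ (k, Suc k) * (of_bool (i = k) - of_bool (i = Suc k))"
    using k by (simp add: sum_subtractf right_diff_distrib)
  finally show ?thesis .
qed

definition green :: "nat \<Rightarrow> nat \<Rightarrow> real" where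
  "green i j = deg j * (\<Sum>k<n - 1. of_bool (i \<le> k) * (of_bool (j \<le> k) - cum k) / A $$ (k, Suc k))"

text \<open>Each edge contributes zero because \<open>cum k\<close> is the degree-weighted mean of
  the indicator of \<open>j \<le> k\<close>. This vanishing later removes the auxiliary vector from
  the trace.\<close>

lemma green_row_sum: "(\<Sum>j<n. green i j) = 0"
proof -
  have z: "(\<Sum>j<n. deg j * (of_bool (j \<le> k) - cum k)) = 0" if "k < n - 1" for k
  proof -
    have "(\<Sum>j<n. deg j * (of_bool (j \<le> k) - cum k))
        = (\<Sum>j<n. deg j * of_bool (j \<le> k)) - vol * cum k"
      by (simp add: right_diff_distrib sum_subtractf vol_def sum_distrib_right)
    also have "\<dots> = 0" using that by (subst sum_atMost_eq_sum_of_bool) (simp_all add: cum_def)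
    finally show ?thesis .
  qed
  have "(\<Sum>j<n. green i j) = (\<Sum>k<n - 1. \<Sum>j<n.
          of_bool (i \<le> k) / A $$ (k, Suc k) * (deg j * (of_bool (j \<le> k) - cum k)))"
    unfolding green_def sum_distrib_left by (subst sum.swap) (simp add: ac_simps)
  also have "\<dots> = 0"
    unfolding sum_distrib_left[symmetric] by (simp add: z)
  finally show ?thesis .
qed

text \<open>On the diagonal the two indicators coincide, so their product leaves the factor
  \<open>1 - cum k\<close> on the rows up to \<open>k\<close>, whose degrees add up to
  \<open>vol * cum k\<close>.\<close>

lemma green_trace:
  "(\<Sum>i<n. green i i) = (\<Sum>k<n - 1. vol * cum k * (1 - cum k) / A $$ (k, Suc k))"
proof -
  have "(\<Sum>i<n. green i i) = (\<Sum>k<n - 1. \<Sum>i<n.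
          (1 - cum k) / A $$ (k, Suc k) * (deg i * of_bool (i \<le> k)))"
    unfolding green_def sum_distrib_left
    by (subst sum.swap) (intro sum.cong, auto)
  also have "\<dots> = (\<Sum>k<n - 1. vol * cum k * (1 - cum k) / A $$ (k, Suc k))"
  proof (rule sum.cong)
    fix k assume "k \<in> {..<n - 1}"
    then have "(\<Sum>i<n. deg i * of_bool (i \<le> k)) = vol * cum k"
      by (subst sum_atMost_eq_sum_of_bool) (simp_all add: cum_def)
    then show "(\<Sum>i<n. (1 - cum k) / A $$ (k, Suc k) * (deg i * of_bool (i \<le> k)))
        = vol * cum k * (1 - cum k) / A $$ (k, Suc k)"
      unfolding sum_distrib_left[symmetric] by simp
  qed simp
  finally show ?thesis .
qed

definition p :: "nat \<Rightarrow> nat \<Rightarrow> real" where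
  "p i j = A $$ (i, j) / deg i"

lemma p_row_sum: "i < n \<Longrightarrow> (\<Sum>j<n. p i j) = 1"
  by (simp add: p_def deg_def[symmetric] flip: sum_divide_distrib)

text \<open>By \<open>laplacian_step\<close> the edge \<open>k\<close> feeds only the rows
  \<open>k\<close> and \<open>Suc k\<close>, and its weight cancels. Row \<open>i\<close> thus keeps
  the difference of two consecutive values of \<open>g\<close>.\<close>

lemma green_equation:
  assumes i: "i < n" and j: "j < n"
  shows "(\<Sum>l<n. (of_bool (i = l) - p i l) * green l j) = of_bool (i = j) - deg j / vol"
proof -
  define g where "g k = of_bool (j \<le> k) - cum k" for k
  \<comment> \<open>The last row has no edge to its right; this zero stands in for the missing
    term.\<close>
  have last: "g (n - 1) = 0" using j cum_last by (auto simp: g_def)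
  have step: "(\<Sum>l<n. (of_bool (i = l) - p i l) * of_bool (l \<le> k)) / A $$ (k, Suc k)
      = (of_bool (i = k) - of_bool (i = Suc k)) / deg i" if k: "k < n - 1" for k
  proof -
    have nz: "A $$ (k, Suc k) \<noteq> 0" using A_edge[of k] k by fastforce
    have "(\<Sum>l<n. (of_bool (i = l) - p i l) * of_bool (l \<le> k))
        = of_bool (i \<le> k) - (\<Sum>l<n. A $$ (i, l) * of_bool (l \<le> k)) / deg i"
    proof -
      have "(\<Sum>l<n. of_bool (i = l) * of_bool (l \<le> k)) = (of_bool (i \<le> k) :: real)"
        using sum_of_bool_eq(2)[OF i, of "\<lambda>l. of_bool (l \<le> k)"] by (simp only: mult.commute)
      then show ?thesis
        by (simp only: left_diff_distrib sum_subtractf p_def sum_divide_distrib times_divide_eq_left)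
    qed
    also have "\<dots> = (deg i * of_bool (i \<le> k) - (\<Sum>l<n. A $$ (i, l) * of_bool (l \<le> k))) / deg i"
      using i by (simp add: diff_divide_distrib)
    also have "\<dots> = A $$ (k, Suc k) * (of_bool (i = k) - of_bool (i = Suc k)) / deg i"
      using laplacian_step[OF i, of k] k by simp
    finally show ?thesis using nz by simp
  qed
  have "(\<Sum>l<n. (of_bool (i = l) - p i l) * green l j)
      = (\<Sum>k<n - 1. deg j * g k *
          ((\<Sum>l<n. (of_bool (i = l) - p i l) * of_bool (l \<le> k)) / A $$ (k, Suc k)))"
    unfolding green_def g_def sum_distrib_left sum_divide_distrib
    by (subst sum.swap) (simp add: ac_simps)
  also have "\<dots> = (\<Sum>k<n - 1. deg j / deg i * (g k * of_bool (i = k) - g k * of_bool (i = Suc k)))"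
  proof (rule sum.cong)
    fix k assume "k \<in> {..<n - 1}"
    then have k: "k < n - 1" by simp
    show "deg j * g k * ((\<Sum>l<n. (of_bool (i = l) - p i l) * of_bool (l \<le> k)) / A $$ (k, Suc k))
        = deg j / deg i * (g k * of_bool (i = k) - g k * of_bool (i = Suc k))"
      unfolding step[OF k] by (simp add: right_diff_distrib)
  qed simp
  also have "\<dots> = deg j / deg i *
      ((\<Sum>k<n - 1. g k * of_bool (i = k)) - (\<Sum>k<n - 1. g k * of_bool (i = Suc k)))"
    by (simp only: sum_subtractf sum_distrib_left[symmetric])
  also have "(\<Sum>k<n - 1. g k * of_bool (i = k)) = g i"
  proof (cases "i = n - 1")
    case True
    then show ?thesis using last by simp
  next
    case False
    then show ?thesis using i by (intro sum_of_bool_eq(2)) simp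
  qed
  \<comment> \<open>From \<open>i - 1\<close> to \<open>i\<close> the indicator in \<open>g\<close>
    jumps exactly if \<open>i = j\<close>, and \<open>cum\<close> grows by
    \<open>deg i / vol\<close>. In row 0 the subtracted sum is zero.\<close>
  also have "g i - (\<Sum>k<n - 1. g k * of_bool (i = Suc k)) = of_bool (i = j) - deg i / vol"
  proof (cases i)
    case 0
    then show ?thesis by (auto simp: g_def cum_def)
  next
    case (Suc r)
    have "(\<Sum>k<n - 1. g k * of_bool (i = Suc k)) = g r"
      using i unfolding Suc nat.inject by (intro sum_of_bool_eq(2)) simp
    then show ?thesis using Suc cum_Suc[of r] by (auto simp: g_def)
  qed
  also have "deg j / deg i * (of_bool (i = j) - deg i / vol) = of_bool (i = j) - deg j / vol"
    using i by (auto simp: right_diff_distrib)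
  finally show ?thesis .
qed

section \<open>The transition matrix and its Kemeny constant\<close>

lemma degree_vec_eq: "i < n \<Longrightarrow> degree_vec A $ i = deg i"
  by (simp add: degree_vec_def ones_def deg_def scalar_prod_def atLeast0LessThan)

lemma degree_mat_eq: "degree_mat A = mat_diag n deg"
  unfolding degree_mat_def by (rule eq_matI) (auto simp: mat_diag_def degree_vec_eq)

lemma inv_degree_mat: "inv_mat (degree_mat A) = mat_diag n (\<lambda>i. 1 / deg i)"
  unfolding degree_mat_eq
  by (rule inv_mat_eqI(2)[where n = n]) (auto simp: mat_diag_def one_mat_def mat_diag_diag[unfolded mat_diag_def])

lemma transition_mat_eq: "transition_mat A = mat n n (\<lambda>(i, j). p i j)"
  unfolding transition_mat_def inv_degree_mat mat_diag_mult_left[OF A_carrier]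
  by (rule eq_matI) (auto simp: p_def)

lemma transition_dim [simp]: "dim_row (transition_mat A) = n" "dim_col (transition_mat A) = n"
  by (simp_all add: transition_mat_eq)

text \<open>
  \<open>G - 1 v\<^sup>T G + 1 \<pi>\<^sup>T\<close> is the inverse of \<open>I - P + 1 v\<^sup>T\<close>; as \<open>G 1 = 0\<close>, its trace is
  \<open>trace G + 1\<close> for every \<open>v\<close>.
\<close>
lemma has_kemeny_transition:
  "has_kemeny (transition_mat A) (\<Sum>k<n - 1. vol * cum k * (1 - cum k) / A $$ (k, Suc k))"
  unfolding has_kemeny_def Let_def transition_dim
proof (intro conjI ballI impI)
  show "square_mat (transition_mat A)" by simp
  show "transition_mat A *\<^sub>v ones n = ones n"
    by (rule eq_vecI)
      (auto simp: transition_mat_eq ones_def scalar_prod_def atLeast0LessThan p_row_sum)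
next
  fix v :: "real vec" assume v: "v \<in> carrier_vec n" and "v \<bullet> ones n = 1"
  then have v1: "(\<Sum>l<n. v $ l) = 1"
    by (simp add: ones_def scalar_prod_def atLeast0LessThan)
  define u where "u j = (\<Sum>l<n. v $ l * green l j)" for j
  let ?M = "1\<^sub>m n - transition_mat A + outer_prod (ones n) v"
  define N where "N = mat n n (\<lambda>(i, j). green i j + (deg j / vol - u j))"
  have M: "?M = mat n n (\<lambda>(i, l). (of_bool (i = l) - p i l) + v $ l)"
    using v by (intro eq_matI) (auto simp: transition_mat_eq outer_prod_def ones_def)
  have MN: "?M * N = 1\<^sub>m n"
  proof (rule eq_matI)
    fix i j assume "i < dim_row (1\<^sub>m n)" "j < dim_col (1\<^sub>m n)"
    then have i: "i < n" and j: "j < n" by auto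
    have row0: "(\<Sum>l<n. of_bool (i = l) - p i l) = 0"
      using sum_of_bool_eq(2)[OF i, of "\<lambda>_. 1"] i by (simp add: sum_subtractf p_row_sum)
    have "(?M * N) $$ (i, j)
        = (\<Sum>l<n. ((of_bool (i = l) - p i l) + v $ l) * (green l j + (deg j / vol - u j)))"
      unfolding M N_def using i j by (simp add: scalar_prod_def atLeast0LessThan)
    \<comment> \<open>The last summand of \<open>N\<close> does not depend on the row
      \<open>l\<close>, so \<open>I - P\<close> annihilates it and \<open>v\<close> reproduces it.
      It then cancels both \<open>u j\<close> and the defect \<open>- deg j / vol\<close> of the
      Green equation.\<close>
    also have "\<dots> = (\<Sum>l<n. (of_bool (i = l) - p i l) * green l j) + u j
        + ((\<Sum>l<n. of_bool (i = l) - p i l) + (\<Sum>l<n. v $ l)) * (deg j / vol - u j)"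
      unfolding u_def by (simp only: distrib_left distrib_right sum.distrib sum_distrib_right ac_simps)
    also have "\<dots> = of_bool (i = j)"
      by (simp only: green_equation[OF i j] row0 v1) simp
    finally show "(?M * N) $$ (i, j) = 1\<^sub>m n $$ (i, j)" using i j by simp
  qed (use M in \<open>auto simp: N_def\<close>)
  have carr: "?M \<in> carrier_mat n n" "N \<in> carrier_mat n n" unfolding M N_def by auto
  note inv = inv_mat_eqI[OF carr MN]
  show "invertible_mat ?M" by (rule inv(1))
  \<comment> \<open>This sum is the only part of the trace that involves \<open>v\<close>.\<close>
  have "(\<Sum>j<n. u j) = (\<Sum>l<n. v $ l * (\<Sum>j<n. green l j))"
    unfolding u_def sum_distrib_left by (rule sum.swap)
  then have "(\<Sum>j<n. u j) = 0" by (simp add: green_row_sum)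
  then have "mat_trace N = (\<Sum>i<n. green i i) + (\<Sum>i<n. deg i) / vol"
    by (simp add: mat_trace_def N_def sum.distrib sum_subtractf sum_divide_distrib)
  then have "mat_trace N = (\<Sum>i<n. green i i) + 1"
    unfolding vol_def[symmetric] by simp
  then show "mat_trace (inv_mat ?M) - 1 = (\<Sum>k<n - 1. vol * cum k * (1 - cum k) / A $$ (k, Suc k))"
    unfolding inv(2) by (simp only: green_trace add_diff_cancel_right')
qed

lemma kemeny_transition:
  "kemeny (transition_mat A) = (\<Sum>k<n - 1. vol * cum k * (1 - cum k) / A $$ (k, Suc k))"
proof -
  have "0 < dim_row (transition_mat A)" using two_le by simp
  then show ?thesis
    unfolding kemeny_def
    by (intro the_equality[where P = "has_kemeny (transition_mat A)"] has_kemeny_transition)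
      (rule has_kemeny_unique[OF _ has_kemeny_transition])
qed

section \<open>The stationary distribution\<close>

text \<open>Multiplying the row vector \<open>x (I - P) = 0\<close> by the Green matrix leaves
  \<open>x\<close> minus its entry sum times the degree distribution, which gives uniqueness.
  Existence is reversibility of the walk.\<close>

lemma stationary_iff:
  "is_stationary_distribution (transition_mat A) x \<longleftrightarrow> x = vec n (\<lambda>i. deg i / vol)"
proof
  assume x: "is_stationary_distribution (transition_mat A) x"
  then have dim: "dim_vec x = n" and sum1: "(\<Sum>i<n. x $ i) = 1"
    and inv: "transpose_mat (transition_mat A) *\<^sub>v x = x"
    by (auto simp: is_stationary_distribution_def)
  have bal: "(\<Sum>i<n. x $ i * (of_bool (i = l) - p i l)) = 0" if l: "l < n" for l
  proof -
    have "(\<Sum>i<n. x $ i * of_bool (i = l)) = x $ l"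
      using l by (rule sum_of_bool_eq(1))
    moreover have "x $ l = (\<Sum>i<n. x $ i * p i l)"
      using arg_cong[OF inv, of "\<lambda>y. y $ l"] l dim
      by (simp add: transition_mat_eq scalar_prod_def atLeast0LessThan ac_simps)
    ultimately show ?thesis by (simp add: right_diff_distrib sum_subtractf)
  qed
  show "x = vec n (\<lambda>i. deg i / vol)"
  proof (rule eq_vecI)
    fix j assume "j < dim_vec (vec n (\<lambda>i. deg i / vol))"
    then have j: "j < n" by simp
    have "0 = (\<Sum>l<n. (\<Sum>i<n. x $ i * (of_bool (i = l) - p i l)) * green l j)"
      by (simp add: bal)
    also have "\<dots> = (\<Sum>i<n. x $ i * (\<Sum>l<n. (of_bool (i = l) - p i l) * green l j))"
      unfolding sum_distrib_left sum_distrib_right by (subst sum.swap) (simp add: ac_simps)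
    also have "\<dots> = (\<Sum>i<n. x $ i * (of_bool (i = j) - deg j / vol))"
      using j by (intro sum.cong) (simp_all add: green_equation)
    also have "\<dots> = (\<Sum>i<n. x $ i * of_bool (i = j)) - (\<Sum>i<n. x $ i) * (deg j / vol)"
      by (simp only: right_diff_distrib sum_subtractf sum_distrib_right)
    also have "(\<Sum>i<n. x $ i * of_bool (i = j)) = x $ j"
      using j by (rule sum_of_bool_eq(1))
    finally show "x $ j = vec n (\<lambda>i. deg i / vol) $ j" using j sum1 by simp
  qed (simp add: dim)
next
  have col: "(\<Sum>i<n. p i j * (deg i / vol)) = deg j / vol" if j: "j < n" for j
  proof -
    \<comment> \<open>Detailed balance: the degree cancels, and symmetry of \<open>A\<close> turns
      the column sum into a row sum.\<close>
    have "(\<Sum>i<n. p i j * (deg i / vol)) = (\<Sum>i<n. A $$ (j, i) / vol)"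
      using j A_sym by (intro sum.cong) (auto simp: p_def)
    then show ?thesis by (simp add: deg_def flip: sum_divide_distrib)
  qed
  assume x: "x = vec n (\<lambda>i. deg i / vol)"
  show "is_stationary_distribution (transition_mat A) x"
    unfolding is_stationary_distribution_def transition_dim
  proof (intro conjI)
    show "x \<in> carrier_vec n" unfolding x by simp
    show "transpose_mat (transition_mat A) *\<^sub>v x = x"
      unfolding x using col
      by (intro eq_vecI) (simp_all add: transition_mat_eq scalar_prod_def atLeast0LessThan)
    show "\<forall>i<n. 0 \<le> x $ i" unfolding x using deg_pos vol_pos by (auto intro!: divide_nonneg_nonneg less_imp_le)
    show "(\<Sum>i<n. x $ i) = 1" unfolding x by (simp flip: sum_divide_distrib vol_def)
  qed
qed

lemma stationary_distribution_eq:
  "stationary_distribution (transition_mat A) = vec n (\<lambda>i. deg i / vol)"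
  unfolding stationary_distribution_def stationary_iff by simp

section \<open>Moving edge weight into loops\<close>

text \<open>\<open>edge_vec\<close> counts vertices from 1, so the edge affected joins the rows
  \<open>k\<close> and \<open>Suc k\<close>. The outer product adds to their diagonal entries what
  it takes from the edge.\<close>

definition weakened :: "nat \<Rightarrow> real \<Rightarrow> real mat" where
  "weakened k t = A + (t * A $$ (k, Suc k)) \<cdot>\<^sub>m
     outer_prod (edge_vec n (Suc k) (Suc (Suc k))) (edge_vec n (Suc k) (Suc (Suc k)))"

lemma weakened_carrier: "weakened k t \<in> carrier_mat n n"
  by (auto simp: weakened_def outer_prod_def edge_vec_def)

lemma weakened_entry:
  assumes "i < n" "j < n" "Suc k < n"
  shows "weakened k t $$ (i, j) = A $$ (i, j) + t * A $$ (k, Suc k) *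
     ((of_bool (i = k) - of_bool (i = Suc k)) * (of_bool (j = k) - of_bool (j = Suc k)))"
  using assms by (simp add: weakened_def outer_prod_def edge_vec_def unit_vec_def of_bool_def)

text \<open>Only four entries change: the loops grow as \<open>0 \<le> t\<close>, and the edge keeps
  the positive fraction \<open>1 - t\<close> of its weight.\<close>

lemma weakened_one_path:
  assumes k: "Suc k < n" and t: "0 \<le> t" "t < 1"
  shows "one_path n (weakened k t)"
proof
  show "2 \<le> n" by (rule two_le)
  let ?c = "A $$ (k, Suc k)"
  have c: "0 \<le> t * ?c" "t * ?c < ?c" using A_edge[OF k] t by auto
  have t1: "t \<le> 1" using t by simp
  have kn: "k < n" using k by simp
  have carr: "weakened k t \<in> carrier_mat n n" by (rule weakened_carrier)
  show "one_path_adjacency n (weakened k t)"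
    unfolding one_path_adjacency_def
  proof (intro conjI allI impI)
    show "transpose_mat (weakened k t) = weakened k t"
      using carr by (intro eq_matI) (auto simp: weakened_entry k A_sym)
    show "0 \<le> weakened k t $$ (i, j)" if ij: "i < n" "j < n" for i j
      using c t1 A_nonneg[OF ij] A_sym[OF kn k] by (auto simp: weakened_entry ij k of_bool_def)
    show "weakened k t $$ (i, j) = 0" if ij: "i < n" "j < n" "i + 1 < j \<or> j + 1 < i" for i j
      using A_far[OF ij] ij by (auto simp: weakened_entry k of_bool_def)
    show "0 < weakened k t $$ (i, i + 1)" if i: "i + 1 < n" for i
      using c A_edge[of i] i by (auto simp: weakened_entry k of_bool_def)
  qed (rule carr)
qed

text \<open>The entries of the edge vector sum to zero, so the correction has zero row sums.\<close>

lemma deg_weakened: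
  assumes k: "Suc k < n" and t: "0 \<le> t" "t < 1" and i: "i < n"
  shows "one_path.deg n (weakened k t) i = deg i"
proof -
  have "(\<Sum>j<n. (of_bool (j = k) - of_bool (j = Suc k) :: real)) = 0"
    using k by (simp add: sum_subtractf of_bool_def)
  then show ?thesis
    unfolding one_path.deg_def[OF weakened_one_path[OF k t]] deg_def
    using i k by (simp add: weakened_entry sum.distrib flip: sum_distrib_left)
qed

text \<open>With equal degrees both sides carry the same inverse degree matrix, which distributes
  over the correction. All results on paths thereby apply to the perturbed matrix.\<close>

lemma perturbed_eq:
  assumes k: "Suc k < n" and t: "0 \<le> t" "t < 1"
  shows "perturbed_transition_mat A (Suc k) (Suc (Suc k)) t = transition_mat (weakened k t)"
proof -
  interpret W: one_path n "weakened k t" by (rule weakened_one_path[OF k t])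
  define E where "E = outer_prod (edge_vec n (Suc k) (Suc (Suc k))) (edge_vec n (Suc k) (Suc (Suc k)))"
  have E: "E \<in> carrier_mat n n" by (auto simp: E_def outer_prod_def edge_vec_def)
  have "degree_mat (weakened k t) = degree_mat A"
    unfolding W.degree_mat_eq degree_mat_eq
    by (rule eq_matI) (auto simp: mat_diag_def deg_weakened[OF k t])
  then have "transition_mat (weakened k t)
      = mat_diag n (\<lambda>i. 1 / deg i) * (A + (t * A $$ (k, Suc k)) \<cdot>\<^sub>m E)"
    unfolding transition_mat_def inv_degree_mat[symmetric] by (simp add: weakened_def E_def)
  also have "\<dots> = transition_mat A + (t * A $$ (k, Suc k)) \<cdot>\<^sub>m (mat_diag n (\<lambda>i. 1 / deg i) * E)"
    unfolding transition_mat_def inv_degree_mat using A_carrier E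
    by (simp add: mult_add_distrib_mat[of _ n n _ n] mult_smult_distrib[of _ n n _ n])
  finally show ?thesis
    unfolding perturbed_transition_mat_def inv_degree_mat by (simp add: E_def Let_def)
qed

lemma vol_weakened:
  assumes "Suc k < n" "0 \<le> t" "t < 1"
  shows "one_path.vol n (weakened k t) = vol"
  unfolding one_path.vol_def[OF weakened_one_path[OF assms]] vol_def
  using deg_weakened[OF assms] by simp

lemma cum_weakened:
  assumes "Suc k < n" "0 \<le> t" "t < 1" "i < n"
  shows "one_path.cum n (weakened k t) i = cum i"
  unfolding one_path.cum_def[OF weakened_one_path[OF assms(1-3)]] cum_def
    vol_weakened[OF assms(1-3)]
  using deg_weakened[OF assms(1-3)] assms(4) by simp

section \<open>The derivative of Kemeny's constant\<close>

lemma kemeny_perturbed: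
  assumes k: "Suc k < n" and t: "0 < t" "t < 1"
  shows "kemeny (perturbed_transition_mat A (Suc k) (Suc (Suc k)) t) - kemeny (transition_mat A)
     = vol * cum k * (1 - cum k) / A $$ (k, Suc k) * (1 / (1 - t) - 1)"
proof -
  have t0: "0 \<le> t" using t by simp
  interpret W: one_path n "weakened k t" by (rule weakened_one_path[OF k t0 t(2)])
  let ?f = "\<lambda>i. vol * cum i * (1 - cum i) / A $$ (i, Suc i)"
  have "vol * cum i * (1 - cum i) / weakened k t $$ (i, Suc i)
      = ?f i + (if i = k then ?f k * (1 / (1 - t) - 1) else 0)" if "i < n - 1" for i
  proof (cases "i = k")
    case True
    have "weakened k t $$ (k, Suc k) = A $$ (k, Suc k) * (1 - t)"
      using k by (simp add: weakened_entry algebra_simps)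
    then have "vol * cum i * (1 - cum i) / weakened k t $$ (i, Suc i) = ?f k * (1 / (1 - t))"
      using True by simp
    then show ?thesis using True by (simp only: if_True right_diff_distrib) simp
  next
    case False
    have "weakened k t $$ (i, Suc i) = A $$ (i, Suc i)"
      using that k False by (auto simp: weakened_entry)
    then show ?thesis using False by simp
  qed
  then have "kemeny (transition_mat (weakened k t))
      = (\<Sum>i<n - 1. ?f i + (if i = k then ?f k * (1 / (1 - t) - 1) else 0))"
    unfolding W.kemeny_transition vol_weakened[OF k t0 t(2)]
    using cum_weakened[OF k t0 t(2)] by (intro sum.cong) auto
  also have "\<dots> = kemeny (transition_mat A) + ?f k * (1 / (1 - t) - 1)"
    unfolding kemeny_transition sum.distrib using k by simp
  finally show ?thesis unfolding perturbed_eq[OF k t0 t(2)] by simp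
qed

text \<open>For \<open>0 < t < 1\<close> the quotient is exactly the claimed limit divided by
  \<open>1 - t\<close>.\<close>

lemma kemeny_quotient_tendsto:
  assumes k: "Suc k < n"
  shows "(kemeny_quotient A (Suc k) (Suc (Suc k))
            \<longlongrightarrow> vol * cum k * (1 - cum k) / A $$ (k, Suc k)) (at_right 0)"
proof (rule Lim_transform_eventually)
  let ?L = "vol * cum k * (1 - cum k) / A $$ (k, Suc k)"
  have "((\<lambda>t. ?L / (1 - t)) \<longlongrightarrow> ?L / (1 - 0)) (at_right 0)"
    by (intro tendsto_intros) auto
  then show "((\<lambda>t. ?L / (1 - t)) \<longlongrightarrow> ?L) (at_right 0)" by simp
  have "\<forall>\<^sub>F t in at_right 0. t \<in> {0<..<1::real}"
    by (rule eventually_at_right_real) simp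
  then show "\<forall>\<^sub>F t in at_right 0. ?L / (1 - t) = kemeny_quotient A (Suc k) (Suc (Suc k)) t"
  proof eventually_elim
    case (elim t)
    have "kemeny_quotient A (Suc k) (Suc (Suc k)) t = ?L * ((1 / (1 - t) - 1) / t)"
      unfolding kemeny_quotient_def using elim k by (simp add: kemeny_perturbed)
    also have "(1 / (1 - t) - 1) / t = 1 / (1 - t)"
      using elim by (simp add: field_simps)
    finally show ?case by simp
  qed
qed

lemma edge_centrality_eq:
  assumes "Suc k < n"
  shows "edge_centrality A (Suc k) (Suc (Suc k)) = vol * cum k * (1 - cum k) / A $$ (k, Suc k)"
  unfolding edge_centrality_def
  using kemeny_quotient_tendsto[OF assms] by (intro tendsto_Lim) auto

lemma edge_centrality_exists:
  assumes k: "Suc k < n"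
  shows "edge_centrality_exists A (Suc k) (Suc (Suc k))"
  unfolding edge_centrality_exists_def
proof (intro conjI)
  show "kemeny_defined (transition_mat A)"
    unfolding kemeny_defined_def using has_kemeny_transition by blast
  show "\<exists>m. (kemeny_quotient A (Suc k) (Suc (Suc k)) \<longlongrightarrow> m) (at_right 0)"
    using kemeny_quotient_tendsto[OF k] by blast
  have "\<forall>\<^sub>F t in at_right 0. t \<in> {0<..<1::real}"
    by (rule eventually_at_right_real) simp
  then show "\<forall>\<^sub>F t in at_right 0. kemeny_defined (perturbed_transition_mat A (Suc k) (Suc (Suc k)) t)"
  proof eventually_elim
    case (elim t)
    then have t: "0 \<le> t" "t < 1" by auto
    show ?case
      unfolding kemeny_defined_def perturbed_eq[OF k t]
      using one_path.has_kemeny_transition[OF weakened_one_path[OF k t]] by blast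
  qed
qed

end

theorem theorem4:
  fixes n :: nat and A P :: "real mat" and lam nu sig :: "nat \<Rightarrow> real" and \<pi> :: "real vec"
  assumes n: "n \<ge> 2"
    and A: "one_path_adjacency n A"
    and P: "P = transition_mat A"
    and lam: "\<And>i. i \<le> n - 2 \<Longrightarrow> lam i = P $$ (i, i + 1)"
    and nu: "\<And>i. 1 \<le> i \<Longrightarrow> i \<le> n - 1 \<Longrightarrow> nu i = P $$ (i, i - 1)"
    and \<pi>: "\<pi> = stationary_distribution P"
    and sig: "\<And>k. k \<le> n - 1 \<Longrightarrow> sig k = (\<Sum>j=0..k. \<pi> $ j)"
  shows "(\<forall>q. 1 \<le> q \<and> q \<le> n - 1 \<longrightarrow>
            edge_centrality_exists A q (q + 1) \<and>
            edge_centrality A q (q + 1)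
              = sig (q - 1) * (1 - sig (q - 1)) / (lam (q - 1) * \<pi> $ (q - 1)))
       \<and> (\<exists>!x. is_stationary_distribution P x)
       \<and> is_stationary_distribution P \<pi>
       \<and> \<pi> $ 0 = inverse (1 + (\<Sum>i=1..n-1. \<Prod>l=0..i-1. lam l / nu (l + 1)))
       \<and> (\<forall>i. 1 \<le> i \<and> i \<le> n - 1 \<longrightarrow>
            \<pi> $ i = \<pi> $ 0 * (\<Prod>l=0..i-1. lam l / nu (l + 1)))
       \<and> ((\<forall>i<n. \<forall>j<n. A $$ (i, j) = (if j = i + 1 \<or> i = j + 1 then 1 else 0)) \<longrightarrow>
            lam 0 = 1 \<and> nu (n - 1) = 1
          \<and> (\<forall>q. 1 \<le> q \<and> q \<le> n - 2 \<longrightarrow> lam q = 1 / 2 \<and> nu (n - q - 1) = 1 / 2)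
          \<and> \<pi> = (1 / (real n - 1)) \<cdot>\<^sub>v vec n (\<lambda>i. if i = 0 \<or> i = n - 1 then 1 / 2 else 1)
          \<and> (\<forall>q \<le> n - 2. sig q = (2 * real q + 1) / (2 * (real n - 1)))
          \<and> (\<forall>q. 1 \<le> q \<and> q \<le> n - 1 \<longrightarrow>
               edge_centrality A q (q + 1)
                 = 1 / (2 * (real n - 1)) * (2 * real q - 1) * (2 * real n - 2 * real q - 1)))"
proof -
  interpret one_path n A using n A by unfold_locales
  have pi_eq: "\<pi> = vec n (\<lambda>i. deg i / vol)"
    unfolding \<pi> P by (rule stationary_distribution_eq)
  have pi_nth: "\<pi> $ i = deg i / vol" if "i < n" for i
    using that by (simp add: pi_eq)
  have sig_eq: "sig k = cum k" if "k < n" for k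
  proof -
    have "sig k = (\<Sum>j=0..k. \<pi> $ j)" using that by (intro sig) simp
    also have "\<dots> = (\<Sum>j=0..k. deg j / vol)" using that by (intro sum.cong) (auto simp: pi_nth)
    finally show ?thesis by (simp add: cum_def sum_divide_distrib atMost_atLeast0)
  qed
  have lam_eq: "lam i = A $$ (i, Suc i) / deg i" if "Suc i < n" for i
    using that lam[of i] by (simp add: P transition_mat_eq p_def)
  have nu_eq: "nu (Suc i) = A $$ (i, Suc i) / deg (Suc i)" if "Suc i < n" for i
    using that nu[of "Suc i"] A_sym[of i "Suc i"] by (simp add: P transition_mat_eq p_def)
  \<comment> \<open>By symmetry \<open>lam l\<close> and \<open>nu (l + 1)\<close> share the
    numerator \<open>A $$ (l, Suc l)\<close>, so the product of degree ratios telescopes.\<close>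
  have ratio: "(\<Prod>l<i. lam l / nu (l + 1)) = deg i / deg 0" if "i < n" for i
    using that
  proof (induction i)
    case (Suc i)
    then have "lam i / nu (Suc i) = deg (Suc i) / deg i"
      using A_edge[of i] by (simp add: lam_eq nu_eq field_simps)
    then show ?case using Suc by simp
  qed simp
  have ratio': "(\<Prod>l=0..i-1. lam l / nu (l + 1)) = deg i / deg 0" if "1 \<le> i" "i < n" for i
  proof -
    \<comment> \<open>False for \<open>i = 0\<close>, where truncated subtraction would leave the
      index 0.\<close>
    have "{0..i-1} = {..<i}" using that by auto
    then show ?thesis using ratio[OF that(2)] by simp
  qed
  \<comment> \<open>The denominator \<open>lam k * \<pi> $ k\<close> equals
    \<open>A $$ (k, Suc k) / vol\<close>.\<close>
  have central: "edge_centrality A (Suc k) (Suc (Suc k))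
      = sig k * (1 - sig k) / (lam k * \<pi> $ k)" if "Suc k < n" for k
    using that by (simp add: edge_centrality_eq sig_eq lam_eq pi_nth mult.assoc mult.left_commute)
  have general: "edge_centrality_exists A q (q + 1) \<and>
      edge_centrality A q (q + 1) = sig (q - 1) * (1 - sig (q - 1)) / (lam (q - 1) * \<pi> $ (q - 1))"
    if "1 \<le> q" "q \<le> n - 1" for q
    using that edge_centrality_exists[of "q - 1"] central[of "q - 1"] by simp
  have "1 + (\<Sum>i=1..n-1. \<Prod>l=0..i-1. lam l / nu (l + 1)) = 1 + (\<Sum>i=1..n-1. deg i / deg 0)"
    using two_le by (intro arg_cong[of _ _ "(+) 1"] sum.cong) (auto simp only: ratio' atLeastAtMost_iff)
  also have "\<dots> = vol / deg 0"
  proof -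
    have "{..<n} = insert 0 {1..n-1}" using two_le by auto
    then have "vol = deg 0 + (\<Sum>i=1..n-1. deg i)" by (simp add: vol_def)
    then show ?thesis using two_le by (simp add: add_divide_distrib sum_divide_distrib)
  qed
  finally have pi0: "\<pi> $ 0 = inverse (1 + (\<Sum>i=1..n-1. \<Prod>l=0..i-1. lam l / nu (l + 1)))"
    using two_le by (simp add: pi_nth)
  have pi_i: "\<pi> $ i = \<pi> $ 0 * (\<Prod>l=0..i-1. lam l / nu (l + 1))" if "1 \<le> i" "i \<le> n - 1" for i
    using that two_le by (subst ratio') (auto simp: pi_nth)
  have unit: "lam 0 = 1 \<and> nu (n - 1) = 1
          \<and> (\<forall>q. 1 \<le> q \<and> q \<le> n - 2 \<longrightarrow> lam q = 1 / 2 \<and> nu (n - q - 1) = 1 / 2)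
          \<and> \<pi> = (1 / (real n - 1)) \<cdot>\<^sub>v vec n (\<lambda>i. if i = 0 \<or> i = n - 1 then 1 / 2 else 1)
          \<and> (\<forall>q \<le> n - 2. sig q = (2 * real q + 1) / (2 * (real n - 1)))
          \<and> (\<forall>q. 1 \<le> q \<and> q \<le> n - 1 \<longrightarrow>
               edge_centrality A q (q + 1)
                 = 1 / (2 * (real n - 1)) * (2 * real q - 1) * (2 * real n - 2 * real q - 1))"
    if unit: "\<forall>i<n. \<forall>j<n. A $$ (i, j) = (if j = i + 1 \<or> i = j + 1 then 1 else 0)"
  proof -
    have deg: "deg i = (if i = 0 \<or> i = n - 1 then 1 else 2)" if i: "i < n" for i
    proof -
      have "deg i = (\<Sum>j<n. (if j = i + 1 then 1 else 0) + (if i = j + 1 then 1 else 0))"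
        unfolding deg_def using i unit by (intro sum.cong) auto
      also have "\<dots> = of_bool (i + 1 < n) + (\<Sum>j<n. if i = j + 1 then 1 else 0)"
        by (simp add: sum.distrib)
      also have "(\<Sum>j<n. if i = j + 1 then 1 else 0) = (of_bool (0 < i) :: real)"
        using i by (cases i) auto
      finally show ?thesis using i two_le by auto
    qed
    \<comment> \<open>The bound keeps the last row out, so row 0 is the only one of degree
      1.\<close>
    have part: "(\<Sum>i\<le>k. deg i) = 2 * real k + 1" if "k \<le> n - 2" for k
      using that by (induction k) (use two_le in \<open>auto simp: deg\<close>)
    have vol: "vol = 2 * (real n - 1)"
    proof -
      have "{..<n} = insert (n - 1) {..n-2}" using two_le by auto
      then have "vol = deg (n - 1) + (\<Sum>i\<le>n-2. deg i)" using two_le by (simp add: vol_def)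
      also have "\<dots> = 2 * (real n - 1)" using two_le by (subst part) (simp_all add: deg of_nat_diff)
      finally show ?thesis .
    qed
    have edge: "A $$ (k, Suc k) = 1" if "Suc k < n" for k using unit that by simp
    have cum: "cum k = (2 * real k + 1) / (2 * (real n - 1))" if "k \<le> n - 2" for k
      using part[OF that] by (simp add: cum_def vol)
    have "edge_centrality A q (q + 1)
        = 1 / (2 * (real n - 1)) * (2 * real q - 1) * (2 * real n - 2 * real q - 1)"
      if q: "1 \<le> q" "q \<le> n - 1" for q
    proof -
      obtain k where k: "q = Suc k" using q by (cases q) auto
      have "cum k = (2 * real q - 1) / vol" using cum[of k] q k by (simp add: vol)
      moreover have "1 - (2 * real q - 1) / vol = (2 * real n - 2 * real q - 1) / vol"
        \<comment> \<open>Denominators are cleared while \<open>vol\<close> is still an opaque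
          nonzero number; only then is its value inserted.\<close>
        by (simp add: field_simps) (simp add: vol)
      ultimately have "edge_centrality A q (q + 1)
          = vol * ((2 * real q - 1) / vol) * ((2 * real n - 2 * real q - 1) / vol)"
        using q k by (simp add: edge_centrality_eq edge)
      then show ?thesis by (simp add: vol)
    qed
    moreover have "lam 0 = 1" using two_le by (simp add: lam_eq edge deg)
    moreover have "nu (n - 1) = 1"
      using two_le nu_eq[of "n - 2"] edge[of "n - 2"] by (simp add: deg numeral_2_eq_2 Suc_diff_Suc)
    moreover have "lam q = 1 / 2 \<and> nu (n - q - 1) = 1 / 2" if "1 \<le> q" "q \<le> n - 2" for q
    proof -
      \<comment> \<open>The range of \<open>q\<close> makes row \<open>n - q - 1\<close> an interior
        one, of degree 2; the successor form is the one \<open>nu_eq\<close> expects.\<close>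
      have "nu (Suc (n - q - 2)) = 1 / 2"
        using that two_le by (subst nu_eq) (auto simp: edge deg)
      moreover have "Suc (n - q - 2) = n - q - 1" using that two_le by simp
      ultimately show ?thesis using that two_le by (simp add: lam_eq edge deg)
    qed
    moreover have "\<pi> = (1 / (real n - 1)) \<cdot>\<^sub>v vec n (\<lambda>i. if i = 0 \<or> i = n - 1 then 1 / 2 else 1)"
      unfolding pi_eq using two_le by (intro eq_vecI) (auto simp: deg vol field_simps)
    moreover have "sig q = (2 * real q + 1) / (2 * (real n - 1))" if "q \<le> n - 2" for q
      using that two_le by (simp add: sig_eq cum)
    ultimately show ?thesis by blast
  qed
  have stat: "is_stationary_distribution P \<pi>" "\<exists>!x. is_stationary_distribution P x"
    unfolding P stationary_iff pi_eq by auto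
  show ?thesis
    using general stat pi0 pi_i unit by blast
qed

end
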